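(* Let $X=[0,1]$ with the Euclidean metric, $T(x)=2x \bmod 1$, and $\mu$ Lebesgue measure. Let $(r_n)_n$ be a decreasing sequence of positive numbers such that $(nr_n)_n$ is also decreasing. Then \[ (\mu\times\mu)(\limsup_n E_{n,r_n}^T)=\begin{cases}0 & \text{if } \sum_{n=1}^\infty nr_n<\infty,\\ 1 & \text{if } \sum_{n=1}^\infty nr_n=\infty.\end{cases} \]
   Context: For $n\in\mathbb{N}$ and $r>0$, $E_{n,r}^{T}:=\{(x,y)\in X\times X : |T^i x- T^j y|<r \text{ for some } 0\le i,j<n\}$; $E_{n,r_n}^T$ is this set with $r=r_n$. *)

theory Defs
  imports "HOL-Analysis.Analysis"
begin

definition X :: "real set" where "X = {0..1}"

definition T :: "real \<Rightarrow> real" where "T x = frac (2 * x)"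

definition E :: "nat \<Rightarrow> real \<Rightarrow> (real \<times> real) set" where
  "E n r = {(x, y) \<in> X \<times> X. \<exists>i<n. \<exists>j<n. \<bar>(T ^^ i) x - (T ^^ j) y\<bar> < r}"

definition limsup_set :: "(nat \<Rightarrow> 'a set) \<Rightarrow> 'a set" where
  "limsup_set A = (\<Inter>m\<in>{1..}. \<Union>n\<in>{m..}. A n)"

definition mu :: "real measure" where "mu = restrict_space lborel X"

end

theory Submission
  imports Defs "HOL-Probability.Probability"
begin

text \<open>
  The convergent case is Borel--Cantelli along \<open>n = 2\<^sup>k\<close>, since \<open>E n r\<close> has measure at most \<open>2 n\<^sup>2 r\<close> and
  \<open>\<Sum> n r\<^sub>n\<close> can be condensed.

  In the divergent case let \<open>l\<^sub>i\<close> be least with \<open>1 / 2 ^ l\<^sub>i \<le> r\<^bsub>i+1\<^esub>\<close>. If the binary digits of \<open>x\<close> from position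
  \<open>i\<close> and of \<open>y\<close> from position \<open>j \<le> i\<close> agree for \<open>l\<^sub>i\<close> digits, then \<open>(x, y)\<close> lies in the set with index
  \<open>i + 1\<close>. This agreement has probability \<open>1 / 2 ^ l\<^sub>i\<close>, and these probabilities sum to infinity over the
  pairs \<open>(i, j)\<close>. Two agreements on different diagonals \<open>i - j\<close> are independent, and on the same diagonal at
  distance \<open>s\<close> they are either independent or jointly have \<open>2 ^ (- s)\<close> times the probability of the later one.
  So the variance of the number of agreements is at most a multiple of its mean, and by Chebyshev's inequality
  almost surely infinitely many agreements occur.
\<close>

section \<open>A second moment inequality\<close>

text \<open>Chebyshev's argument: if \<open>S\<close> counts the events that occur and
  \<open>s = sum p F\<close>, then \<open>(S - s)^2\<close> equals \<open>s^2\<close> where no event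
  occurs. Centring at \<open>s\<close> instead of the mean of \<open>S\<close> means that only lower
  bounds for single events and upper bounds for pairs enter.\<close>

lemma (in prob_space) second_moment_bound:
  fixes B :: "'b \<Rightarrow> 'a set" and p :: "'b \<Rightarrow> real"
  assumes fin: "finite F" and B: "\<And>a. a \<in> F \<Longrightarrow> B a \<in> events"
    and p: "\<And>a. a \<in> F \<Longrightarrow> p a \<le> prob (B a)"
    and pair: "(\<Sum>a\<in>F. \<Sum>b\<in>F. prob (B a \<inter> B b)) \<le> (sum p F)\<^sup>2 + c * sum p F"
    and pos: "sum p F > 0"
  shows "prob (space M - (\<Union>a\<in>F. B a)) \<le> c / sum p F"
proof -
  define s where "s = sum p F"
  define S where "S z = (\<Sum>a\<in>F. indicator (B a) z :: real)" for z
  have sq: "(S z)\<^sup>2 = (\<Sum>a\<in>F. \<Sum>b\<in>F. indicator (B a \<inter> B b) z)" for z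
    by (simp add: S_def power2_eq_square sum_product indicator_inter_arith)
  have ind: "integrable M (indicator A :: _ \<Rightarrow> real)" if "A \<in> events" for A
    using that by (intro integrable_real_indicator) (auto simp: emeasure_eq_measure)
  have int1: "integrable M S" unfolding S_def
    using B by (intro Bochner_Integration.integrable_sum ind)
  have int2: "integrable M (\<lambda>z. (S z)\<^sup>2)" unfolding sq
    using B by (intro Bochner_Integration.integrable_sum ind sets.Int)
  have ES: "expectation S = (\<Sum>a\<in>F. prob (B a))"
    unfolding S_def using B by (subst Bochner_Integration.integral_sum) (auto intro: ind)
  have ES2: "expectation (\<lambda>z. (S z)\<^sup>2) = (\<Sum>a\<in>F. \<Sum>b\<in>F. prob (B a \<inter> B b))"
  proof -
    have "integrable M (indicator (B a \<inter> B b) :: _ \<Rightarrow> real)" if "a \<in> F" "b \<in> F" for a b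
      using B that by (intro ind sets.Int)
    then show ?thesis unfolding sq using B 
      by (subst Bochner_Integration.integral_sum, force)
        (intro sum.cong refl, subst Bochner_Integration.integral_sum, auto)
  qed
  let ?Z = "space M - (\<Union>a\<in>F. B a)"
  have Z: "?Z \<in> events" using fin B by auto
  have "s\<^sup>2 * prob ?Z = expectation (\<lambda>z. s\<^sup>2 * indicator ?Z z)"
    using Z ind[OF Z] by simp
  also have "\<dots> \<le> expectation (\<lambda>z. (S z)\<^sup>2 - 2 * s * S z + s\<^sup>2)"
  proof (rule integral_mono)
    show "integrable M (\<lambda>z. s\<^sup>2 * indicator ?Z z)" using ind[OF Z] by simp
    show "integrable M (\<lambda>z. (S z)\<^sup>2 - 2 * s * S z + s\<^sup>2)" using int1 int2 by auto
    fix z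
    show "s\<^sup>2 * indicator ?Z z \<le> (S z)\<^sup>2 - 2 * s * S z + s\<^sup>2"
    proof (cases "z \<in> ?Z")
      case True
      then have "S z = 0" by (simp add: S_def)
      then show ?thesis using True by simp
    next
      case False
      have "(S z)\<^sup>2 - 2 * s * S z + s\<^sup>2 = (S z - s)\<^sup>2" by (simp add: power2_diff)
      then show ?thesis using False by simp
    qed
  qed
  also have "\<dots> = expectation (\<lambda>z. (S z)\<^sup>2) - 2 * s * expectation S + s\<^sup>2"
    using int1 int2 by (simp add: prob_space)
  also have "\<dots> \<le> (s\<^sup>2 + c * s) - 2 * s * s + s\<^sup>2"
  proof -
    have "s \<le> expectation S" unfolding ES s_def using p by (intro sum_mono)
    then have "2 * s * s \<le> 2 * s * expectation S" using pos by (simp add: s_def)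
    then show ?thesis using pair unfolding ES2 s_def by linarith
  qed
  also have "\<dots> = c * s" by (simp add: power2_eq_square)
  finally have "s * prob ?Z \<le> c"
    using pos unfolding s_def power2_eq_square by simp
  then show ?thesis using pos unfolding s_def by (simp add: field_simps)
qed

section \<open>Binary digits and dyadic cylinders\<close>

text \<open>Digits are read off as visits of the orbit to the upper half of the interval, so
  applying \<open>T\<close> shifts the digit sequence.\<close>

definition digit :: "nat \<Rightarrow> real \<Rightarrow> bool" where
  "digit n x \<longleftrightarrow> (T ^^ n) x \<ge> 1 / 2"

lemma T_eq:
  assumes "0 \<le> x" "x < 1"
  shows "T x = (if x < 1 / 2 then 2 * x else 2 * x - 1)"
proof (cases "x < 1 / 2")
  case True
  then show ?thesis using assms by (simp add: T_def frac_eq)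
next
  case False
  then have "\<lfloor>2 * x\<rfloor> = 1" using assms by (simp add: floor_eq_iff)
  then show ?thesis using False by (simp add: T_def frac_def)
qed

lemma funpow_T_range:
  assumes "x \<in> {0..<1}"
  shows "(T ^^ n) x \<in> {0..<1}"
proof (cases n)
  case 0
  then show ?thesis using assms by simp
next
  case (Suc k)
  then show ?thesis by (simp add: T_def frac_lt_1)
qed

lemma digit_0: "digit 0 x \<longleftrightarrow> x \<ge> 1 / 2"
  by (simp add: digit_def)

lemma digit_Suc: "digit (Suc n) x = digit n (T x)"
  by (simp add: digit_def funpow_swap1)

lemma digit_add: "digit (i + n) x = digit n ((T ^^ i) x)"
  by (simp add: digit_def add.commute[of i] funpow_add)

text \<open>Prepending a first digit \<open>b\<close> is the inverse branch
  \<open>z -> (b + z) / 2\<close> of \<open>T\<close>, which sends a half-open interval to one of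
  half the length. The bounds on \<open>c\<close> are carried through the induction to keep the
  image in the half belonging to \<open>b\<close>.\<close>

lemma cylinder_interval:
  "\<exists>c. {x \<in> {0..<1}. \<forall>n<N. digit n x = u n} = {c..<c + 1 / 2 ^ N} \<and> 0 \<le> c \<and> c + 1 / 2 ^ N \<le> 1"
proof (induction N arbitrary: u)
  case 0
  show ?case by (rule exI[of _ 0]) auto
next
  case (Suc N)
  define e :: real where "e = 1 / 2 ^ N"
  have half: "1 / 2 ^ Suc N = e / 2" by (simp add: e_def)
  obtain c where c: "{x \<in> {0..<1}. \<forall>n<N. digit n x = u (Suc n)} = {c..<c + e}" "0 \<le> c" "c + e \<le> 1"
    using Suc.IH[of "\<lambda>n. u (Suc n)"] unfolding e_def by blast
  define b :: real where "b = (if u 0 then 1 else 0)"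
  have *: "x \<in> {x \<in> {0..<1}. \<forall>n<Suc N. digit n x = u n} \<longleftrightarrow> x \<in> {(b + c) / 2..<(b + c) / 2 + e / 2}" for x
  proof -
    have "x \<in> {x \<in> {0..<1}. \<forall>n<Suc N. digit n x = u n} \<longleftrightarrow>
        x \<in> {0..<1} \<and> (x \<ge> 1 / 2) = u 0 \<and> T x \<in> {x \<in> {0..<1}. \<forall>n<N. digit n x = u (Suc n)}"
      using funpow_T_range[of x 1] by (auto simp: All_less_Suc2 digit_Suc digit_0)
    also have "\<dots> \<longleftrightarrow> x \<in> {0..<1} \<and> (x \<ge> 1 / 2) = u 0 \<and> T x \<in> {c..<c + e}"
      by (simp only: c(1))
    also have "\<dots> \<longleftrightarrow> x \<in> {(b + c) / 2..<(b + c) / 2 + e / 2}"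
    proof (cases "x \<in> {0..<1}")
      case True
      then have x: "0 \<le> x" "x < 1" by auto
      show ?thesis
        using x c(2,3) unfolding T_eq[OF x] b_def by (cases "u 0") (auto simp: field_simps)
    next
      case False
      then show ?thesis
        using c(2,3) unfolding b_def by (cases "u 0") (auto simp: field_simps)
    qed
    finally show ?thesis .
  qed
  show ?case unfolding half
    by (rule exI[of _ "(b + c) / 2"], intro conjI set_eqI *)
      (use c(2,3) in \<open>auto simp: b_def field_simps\<close>)
qed

text \<open>Both points lie in one cylinder. It is a half-open interval, which makes the inequality
  strict, as the definition of \<open>E\<close> requires.\<close>

lemma dist_less_if_digits_agree:
  assumes "x \<in> {0..<1}" "y \<in> {0..<1}" "\<And>n. n < m \<Longrightarrow> digit n x = digit n y"
  shows "\<bar>x - y\<bar> < 1 / 2 ^ m"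
proof -
  obtain c where c: "{z \<in> {0..<1}. \<forall>n<m. digit n z = digit n y} = {c..<c + 1 / 2 ^ m}"
    using cylinder_interval[of m "\<lambda>n. digit n y"] by blast
  have "x \<in> {c..<c + 1 / 2 ^ m}" "y \<in> {c..<c + 1 / 2 ^ m}"
    unfolding c[symmetric] using assms by auto
  then show ?thesis by (auto simp: abs_if)
qed

section \<open>The product probability space\<close>

lemma T_measurable [measurable]: "T \<in> borel_measurable borel"
  unfolding T_def frac_def by measurable

lemma funpow_T_measurable [measurable]: "(T ^^ n) \<in> borel_measurable borel"
  by (induction n) auto

lemma space_mu: "space mu = {0..1}"
  by (simp add: mu_def X_def space_restrict_space)

lemma emeasure_mu: "A \<in> sets borel \<Longrightarrow> A \<subseteq> {0..1} \<Longrightarrow> emeasure mu A = emeasure lborel A"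
  by (simp add: mu_def X_def emeasure_restrict_space)

lemma sets_mu_if_borel: "A \<subseteq> {0..1} \<Longrightarrow> A \<in> sets borel \<Longrightarrow> A \<in> sets mu"
  by (simp add: mu_def X_def sets_restrict_space_iff)

interpretation mu: prob_space mu
  by standard (simp add: space_mu emeasure_mu)

interpretation mu2: pair_prob_space mu mu ..

abbreviation nu :: "(real \<times> real) measure" where "nu \<equiv> mu \<Otimes>\<^sub>M mu"

lemma space_nu: "space nu = {0..1} \<times> {0..1}"
  by (simp add: space_pair_measure space_mu)

lemma borel_measurable_proj_nu [measurable]:
  "fst \<in> borel_measurable nu" "snd \<in> borel_measurable nu"
proof -
  have "(\<lambda>x. x) \<in> measurable mu borel"
    unfolding mu_def by (simp add: measurable_restrict_space1)
  from measurable_compose[OF measurable_fst this] measurable_compose[OF measurable_snd this]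
  show "fst \<in> borel_measurable nu" "snd \<in> borel_measurable nu" by auto
qed

section \<open>Measure bounds by counting cylinders\<close>

lemma cylinder_measure:
  defines "C \<equiv> \<lambda>N u. {x \<in> {0..<1}. \<forall>n<N. digit n x = u n}"
  shows "C N u \<times> C N v \<in> sets nu" "measure nu (C N u \<times> C N v) = 1 / 4 ^ N"
proof -
  have *: "C N u \<in> sets mu \<and> emeasure mu (C N u) = ennreal (1 / 2 ^ N)" for u
  proof -
    obtain c where c: "C N u = {c..<c + 1 / 2 ^ N}" "0 \<le> c" "c + 1 / 2 ^ N \<le> 1"
      using cylinder_interval[of N u] unfolding C_def by blast
    have "C N u \<subseteq> {0..1}" by (auto simp: C_def)
    then show ?thesis using c by (auto simp: emeasure_mu intro!: sets_mu_if_borel)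
  qed
  show "C N u \<times> C N v \<in> sets nu" using * by auto
  have "emeasure nu (C N u \<times> C N v) = ennreal (1 / 2 ^ N) * ennreal (1 / 2 ^ N)"
    using * by (simp add: mu.emeasure_pair_measure_Times)
  also have "\<dots> = ennreal (1 / 4 ^ N)"
    by (simp add: ennreal_mult[symmetric] power_mult_distrib[symmetric])
  finally show "measure nu (C N u \<times> C N v) = 1 / 4 ^ N"
    by (simp add: measure_def)
qed

text \<open>\<open>S\<close> is covered by products of two cylinders of length \<open>N\<close>,
  each of measure \<open>1 / 4 ^ N\<close>. Since the digits at positions in \<open>A\<close> and
  \<open>B\<close> follow from the others, \<open>S\<close> meets at most
  \<open>2 ^ (N - card A) * 2 ^ (N - card B)\<close> of them. All upper bounds for agreements come
  from this count.\<close>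

lemma measure_le_if_digits_determined:
  assumes S: "S \<subseteq> {0..<1} \<times> {0..<1}" and A: "A \<subseteq> {..<N}" and B: "B \<subseteq> {..<N}"
    and det: "\<And>x y x' y'. (x, y) \<in> S \<Longrightarrow> (x', y') \<in> S \<Longrightarrow>
      (\<And>n. n < N \<Longrightarrow> n \<notin> A \<Longrightarrow> digit n x = digit n x') \<Longrightarrow>
      (\<And>n. n < N \<Longrightarrow> n \<notin> B \<Longrightarrow> digit n y = digit n y') \<Longrightarrow>
      \<forall>n<N. digit n x = digit n x' \<and> digit n y = digit n y'"
  shows "measure nu S \<le> 1 / 2 ^ (card A + card B)"
proof -
  define C where "C u = {x \<in> {0..<1}. \<forall>n<N. digit n x = u n}" for u
  define w where "w K x = restrict (\<lambda>n. digit n x) K" for K x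
  \<comment> \<open>\<open>G\<close> collects the pairs of digit words occurring in
    \<open>S\<close>. The map \<open>\<rho>\<close> forgets the digits in \<open>A\<close> and
    \<open>B\<close>, and \<open>det\<close> makes it injective on \<open>G\<close>.\<close>
  define G where "G = (\<lambda>(x, y). (w {..<N} x, w {..<N} y)) ` S"
  define \<rho> where "\<rho> = (\<lambda>(u, v). (restrict u ({..<N} - A) :: nat \<Rightarrow> bool, restrict v ({..<N} - B) :: nat \<Rightarrow> bool))"
  define W where "W = (({..<N} - A) \<rightarrow>\<^sub>E (UNIV :: bool set)) \<times> (({..<N} - B) \<rightarrow>\<^sub>E (UNIV :: bool set))"
  have fin: "finite A" "finite B" using A B finite_subset by auto
  have "finite W" unfolding W_def by (intro finite_cartesian_product finite_PiE) auto
  have cardW: "card W = 2 ^ (N - card A) * 2 ^ (N - card B)"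
    unfolding W_def using fin A B by (simp add: card_cartesian_product card_PiE card_Diff_subset)
  have inj: "inj_on \<rho> G"
  proof (rule inj_onI)
    fix g g' assume "g \<in> G" "g' \<in> G" and eq: "\<rho> g = \<rho> g'"
    then obtain x y x' y' where xy: "(x, y) \<in> S" "(x', y') \<in> S"
      and g: "g = (w {..<N} x, w {..<N} y)" "g' = (w {..<N} x', w {..<N} y')"
      unfolding G_def by auto
    have "restrict (w {..<N} x) ({..<N} - A) = restrict (w {..<N} x') ({..<N} - A)"
      and "restrict (w {..<N} y) ({..<N} - B) = restrict (w {..<N} y') ({..<N} - B)"
      using eq unfolding g \<rho>_def by auto
    then have "digit n x = digit n x'" if "n < N" "n \<notin> A" for n
      using that unfolding w_def by (metis DiffI lessThan_iff restrict_apply')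
    moreover have "digit n y = digit n y'" if "n < N" "n \<notin> B" for n
      using that \<open>restrict (w {..<N} y) ({..<N} - B) = restrict (w {..<N} y') ({..<N} - B)\<close>
      unfolding w_def by (metis DiffI lessThan_iff restrict_apply')
    ultimately have "\<forall>n<N. digit n x = digit n x' \<and> digit n y = digit n y'"
      by (rule det[OF xy])
    then show "g = g'" unfolding g w_def by (auto intro!: restrict_ext)
  qed
  have sub: "\<rho> ` G \<subseteq> W" unfolding \<rho>_def W_def G_def by (auto simp: PiE_def)
  have finG: "finite G" using inj sub \<open>finite W\<close> finite_imageD finite_subset by metis
  have cardG: "card G \<le> card W"
    using card_inj_on_le[OF inj sub \<open>finite W\<close>] .
  have cyl: "C u \<times> C v \<in> sets nu" "measure nu (C u \<times> C v) = 1 / 4 ^ N" for u v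
    using cylinder_measure[of N u v] unfolding C_def by auto
  have "S \<subseteq> (\<Union>g\<in>G. C (fst g) \<times> C (snd g))"
  proof
    fix z assume z: "z \<in> S"
    obtain x y where xy: "z = (x, y)" by (cases z)
    have "(x, y) \<in> C (w {..<N} x) \<times> C (w {..<N} y)"
      using S z unfolding xy C_def w_def by auto
    moreover have "(w {..<N} x, w {..<N} y) \<in> G"
      using z unfolding xy G_def by (intro image_eqI[of _ _ "(x, y)"]) auto
    ultimately show "z \<in> (\<Union>g\<in>G. C (fst g) \<times> C (snd g))"
      unfolding xy by (intro UN_I[of "(w {..<N} x, w {..<N} y)"]) auto
  qed
  then have "measure nu S \<le> measure nu (\<Union>g\<in>G. C (fst g) \<times> C (snd g))"
    using finG cyl by (intro mu2.finite_measure_mono sets.finite_UN) auto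
  also have "\<dots> \<le> (\<Sum>g\<in>G. measure nu (C (fst g) \<times> C (snd g)))"
    using finG cyl by (intro mu2.finite_measure_subadditive_finite) auto
  also have "\<dots> = real (card G) / 4 ^ N"
    by (simp add: cyl)
  also have "\<dots> \<le> real (card W) / 4 ^ N"
    using cardG by (intro divide_right_mono) auto
  also have "\<dots> = 1 / 2 ^ (card A + card B)"
  proof -
    have "card A \<le> N" "card B \<le> N"
      using card_mono[of "{..<N}"] A B by auto
    then have "(2::real) ^ N = 2 ^ (N - card A) * 2 ^ card A" "(2::real) ^ N = 2 ^ (N - card B) * 2 ^ card B"
      by (simp_all flip: power_add)
    moreover have "(4::real) ^ N = 2 ^ N * 2 ^ N" by (simp flip: power_mult_distrib)
    ultimately have "(4::real) ^ N = (2 ^ (N - card A) * 2 ^ card A) * (2 ^ (N - card B) * 2 ^ card B)"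
      by simp
    then show ?thesis by (simp add: cardW power_add field_simps)
  qed
  finally show ?thesis .
qed

section \<open>Agreement of digit windows\<close>

lemma window_offset:
  fixes n i m :: nat
  assumes "n \<in> {i..<i + m}"
  obtains t where "n = i + t" "t < m"
  using assms that[of "n - i"] by auto

text \<open>The point \<open>1\<close> is excluded because it has the same digits as \<open>1 / 2\<close>.\<close>

definition agree :: "nat \<Rightarrow> nat \<Rightarrow> nat \<Rightarrow> (real \<times> real) set" where
  "agree i j m = {(x, y) \<in> {0..<1} \<times> {0..<1}. \<forall>t<m. digit (i + t) x = digit (j + t) y}"

lemma digit_measurable [measurable]: "Measurable.pred borel (digit n)"
  unfolding digit_def by measurable

text \<open>Here \<open>w t\<close> prescribes whether the digits at offset \<open>t\<close> agree
  or differ. Mixed patterns are needed to bound the measure of full agreement from below.\<close>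

lemma digit_pattern_sets:
  "{(x, y) \<in> {0..<1} \<times> {0..<1}. \<forall>t<m. digit (i + t) x = (digit (j + t) y = w t)} \<in> sets nu"
proof -
  have "{z \<in> space nu. fst z < 1 \<and> snd z < 1 \<and>
      (\<forall>t<m. digit (i + t) (fst z) = (digit (j + t) (snd z) = w t))} \<in> sets nu"
    by measurable
  also have "{z \<in> space nu. fst z < 1 \<and> snd z < 1 \<and>
      (\<forall>t<m. digit (i + t) (fst z) = (digit (j + t) (snd z) = w t))} =
      {(x, y) \<in> {0..<1} \<times> {0..<1}. \<forall>t<m. digit (i + t) x = (digit (j + t) y = w t)}"
    by (auto simp: space_nu)
  finally show ?thesis .
qed

lemma agree_sets [measurable]: "agree i j m \<in> sets nu"
  using digit_pattern_sets[of m i j "\<lambda>_. True"] by (simp add: agree_def)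

lemma measure_unit_square: "measure nu ({0..<1} \<times> {0..<1}) = 1"
proof -
  have "{x \<in> {0..<1}. \<forall>n<0. digit n x = True} = {0..<1}" by auto
  then show ?thesis using cylinder_measure(2)[of 0 "\<lambda>_. True" "\<lambda>_. True"] by simp
qed

text \<open>The lower bound follows from upper bounds: the \<open>2 ^ m\<close> patterns of
  agreement and disagreement cover a set of measure 1, and each has measure at most
  \<open>1 / 2 ^ m\<close> because \<open>y\<close> and the pattern determine the window of
  \<open>x\<close>. So no pattern can fall below that value.\<close>

lemma measure_agree_ge: "1 / 2 ^ m \<le> measure nu (agree i j m)"
proof -
  define D where "D w = {(x, y) \<in> {0..<1} \<times> {0..<1}. \<forall>t<m. digit (i + t) x = (digit (j + t) y = w t)}" for w
  define W where "W = {..<m} \<rightarrow>\<^sub>E (UNIV :: bool set)"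
  define w0 where "w0 = restrict (\<lambda>_. True) {..<m}"
  have W: "finite W" "card W = 2 ^ m" "w0 \<in> W"
    unfolding W_def w0_def by (auto simp: card_PiE intro!: finite_PiE)
  have D: "D w \<in> sets nu" for w unfolding D_def by (rule digit_pattern_sets)
  have le: "measure nu (D w) \<le> 1 / 2 ^ m" for w
  proof -
    define N where "N = i + j + m"
    have "measure nu (D w) \<le> 1 / 2 ^ (card ({i..<i + m}) + card ({} :: nat set))"
    proof (rule measure_le_if_digits_determined[where N = N])
      fix x y x' y' assume xy: "(x, y) \<in> D w" "(x', y') \<in> D w"
        and *: "\<And>n. n < N \<Longrightarrow> n \<notin> {i..<i + m} \<Longrightarrow> digit n x = digit n x'"
        and "\<And>n. n < N \<Longrightarrow> n \<notin> {} \<Longrightarrow> digit n y = digit n y'"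
      then have y: "\<And>n. n < N \<Longrightarrow> digit n y = digit n y'" by blast
      have "digit n x = digit n x'" if "n < N" for n
      proof (cases "n \<in> {i..<i + m}")
        case True
        then obtain t where t: "n = i + t" "t < m" by (rule window_offset)
        then have "digit (j + t) y = digit (j + t) y'" by (intro y) (auto simp: N_def)
        then show ?thesis using xy t unfolding D_def by auto
      qed (use * that in auto)
      then show "\<forall>n<N. digit n x = digit n x' \<and> digit n y = digit n y'" using y by auto
    qed (auto simp: D_def N_def)
    then show ?thesis by simp
  qed
  have "{0..<1} \<times> {0..<1} \<subseteq> (\<Union>w\<in>W. D w)"
  proof clarify
    fix x y :: real assume "x \<in> {0..<1}" "y \<in> {0..<1}"
    then have "(x, y) \<in> D (restrict (\<lambda>t. digit (i + t) x = digit (j + t) y) {..<m})"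
      unfolding D_def by auto
    moreover have "restrict (\<lambda>t. digit (i + t) x = digit (j + t) y) {..<m} \<in> W"
      unfolding W_def by simp
    ultimately show "(x, y) \<in> (\<Union>w\<in>W. D w)" by (simp only: UN_iff) (rule bexI)
  qed
  then have "measure nu ({0..<1} \<times> {0..<1}) \<le> measure nu (\<Union>w\<in>W. D w)"
    using W D by (intro mu2.finite_measure_mono) auto
  then have "1 \<le> measure nu (\<Union>w\<in>W. D w)"
    by (simp only: measure_unit_square)
  also have "\<dots> \<le> (\<Sum>w\<in>W. measure nu (D w))"
    using W D by (intro mu2.finite_measure_subadditive_finite) auto
  also have "\<dots> = measure nu (D w0) + (\<Sum>w\<in>W - {w0}. measure nu (D w))"
    using W by (simp add: sum.remove)
  also have "(\<Sum>w\<in>W - {w0}. measure nu (D w)) \<le> (\<Sum>w\<in>W - {w0}. 1 / 2 ^ m)"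
    by (intro sum_mono le)
  also have "\<dots> = 1 - 1 / 2 ^ m"
    using W by (simp add: card_Diff_singleton of_nat_diff field_simps)
  also have "D w0 = agree i j m"
    unfolding D_def w0_def agree_def by auto
  finally show ?thesis by simp
qed

text \<open>With \<open>d = i - j < d' = i' - j'\<close>, a digit of \<open>y\<close> in the first window is read off from \<open>x\<close>, and a digit
  of \<open>x\<close> in the second window from \<open>y\<close>; following both relations lowers the index in \<open>x\<close> by \<open>d' - d\<close>,
  so the recursion terminates and the digits outside these two windows determine all others.\<close>

lemma measure_agree_Int_different_diagonal:
  assumes "i + j' < i' + j"
  shows "measure nu (agree i j m \<inter> agree i' j' m') \<le> 1 / 2 ^ (m + m')"
proof -
  define N where "N = i + j + i' + j' + m + m'"
  have "measure nu (agree i j m \<inter> agree i' j' m') \<le> 1 / 2 ^ (card {i'..<i' + m'} + card {j..<j + m})"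
  proof (rule measure_le_if_digits_determined[where N = N])
    fix x y x' y' assume xy: "(x, y) \<in> agree i j m \<inter> agree i' j' m'" "(x', y') \<in> agree i j m \<inter> agree i' j' m'"
      and fx: "\<And>n. n < N \<Longrightarrow> n \<notin> {i'..<i' + m'} \<Longrightarrow> digit n x = digit n x'"
      and fy: "\<And>n. n < N \<Longrightarrow> n \<notin> {j..<j + m} \<Longrightarrow> digit n y = digit n y'"
    have yx: "digit (j + t) y = digit (j + t) y' \<longleftrightarrow> digit (i + t) x = digit (i + t) x'" if "t < m" for t
      using xy that unfolding agree_def by auto
    have xy': "digit (i' + t) x = digit (i' + t) x' \<longleftrightarrow> digit (j' + t) y = digit (j' + t) y'" if "t < m'" for t
      using xy that unfolding agree_def by auto
    have dx: "digit n x = digit n x'" if "n < N" for n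
      using that
    proof (induction n rule: less_induct)
      case (less n)
      show ?case
      proof (cases "n \<in> {i'..<i' + m'}")
        case True
        then obtain t where t: "n = i' + t" "t < m'" by (rule window_offset)
        have "digit (j' + t) y = digit (j' + t) y'"
        proof (cases "j' + t \<in> {j..<j + m}")
          case True
          then obtain s where s: "j' + t = j + s" "s < m" by (rule window_offset)
          then have "i + s < n" using t assms by linarith
          then have "digit (i + s) x = digit (i + s) x'" using less by auto
          then show ?thesis using yx s by simp
        next
          case False
          then show ?thesis using t by (intro fy) (auto simp: N_def)
        qed
        then show ?thesis using xy' t by simp
      qed (use fx less in auto)
    qed
    have "digit n y = digit n y'" if "n < N" for n
    proof (cases "n \<in> {j..<j + m}")
      case True
      then obtain t where t: "n = j + t" "t < m" by (rule window_offset)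
      then have "digit (i + t) x = digit (i + t) x'" by (intro dx) (auto simp: N_def)
      then show ?thesis using yx t by simp
    qed (use fy that in auto)
    then show "\<forall>n<N. digit n x = digit n x' \<and> digit n y = digit n y'" using dx by auto
  qed (auto simp: agree_def N_def)
  then show ?thesis by (simp add: add.commute)
qed

text \<open>All of \<open>y\<close>, together with the digits of \<open>x\<close> outside both
  windows, determines the rest, so the exponent is the size of the union of the two windows in
  \<open>x\<close>. If they overlap, \<open>m \<le> m'\<close> makes the union an interval of length
  \<open>s + m'\<close>; otherwise the lengths add up.\<close>

lemma measure_agree_Int_same_diagonal:
  assumes "m \<le> m'"
  shows "measure nu (agree i j m \<inter> agree (i + s) (j + s) m') \<le> 1 / 2 ^ (min m s + m')"
proof -
  define N where "N = i + j + s + m + m'"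
  define A where "A = {i..<i + m} \<union> {i + s..<i + s + m'}"
  have A: "card A = min m s + m'"
  proof (cases "s < m")
    case True
    then have "A = {i..<i + s + m'}" using assms by (auto simp: A_def)
    then show ?thesis using True by simp
  next
    case False
    then show ?thesis unfolding A_def by (subst card_Un_disjoint) auto
  qed
  have "measure nu (agree i j m \<inter> agree (i + s) (j + s) m') \<le> 1 / 2 ^ (card A + card ({} :: nat set))"
  proof (rule measure_le_if_digits_determined[where N = N])
    fix x y x' y' assume xy: "(x, y) \<in> agree i j m \<inter> agree (i + s) (j + s) m'"
        "(x', y') \<in> agree i j m \<inter> agree (i + s) (j + s) m'"
      and fx: "\<And>n. n < N \<Longrightarrow> n \<notin> A \<Longrightarrow> digit n x = digit n x'"
      and "\<And>n. n < N \<Longrightarrow> n \<notin> {} \<Longrightarrow> digit n y = digit n y'"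
    then have fy: "\<And>n. n < N \<Longrightarrow> digit n y = digit n y'" by blast
    have 1: "digit (i + t) x = digit (i + t) x'" if "t < m" for t
      using xy that fy[of "j + t"] unfolding agree_def N_def by auto
    have 2: "digit (i + s + t) x = digit (i + s + t) x'" if "t < m'" for t
      using xy that fy[of "j + s + t"] unfolding agree_def N_def by auto
    have "digit n x = digit n x'" if "n < N" for n
    proof (cases "n \<in> A")
      case True
      then consider "n \<in> {i..<i + m}" | "n \<in> {i + s..<i + s + m'}" unfolding A_def by blast
      then show ?thesis
      proof cases
        assume "n \<in> {i..<i + m}"
        then obtain t where "n = i + t" "t < m" by (rule window_offset)
        then show ?thesis using 1 by simp
      next
        assume "n \<in> {i + s..<i + s + m'}"
        then obtain t where "n = i + s + t" "t < m'" by (rule window_offset)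
        then show ?thesis using 2 by simp
      qed
    qed (use fx that in auto)
    then show "\<forall>n<N. digit n x = digit n x' \<and> digit n y = digit n y'" using fy by auto
  qed (auto simp: agree_def N_def A_def)
  then show ?thesis by (simp add: A)
qed

section \<open>Measure bounds for close orbits\<close>

lemma emeasure_lborel_doubling:
  fixes t :: real
  assumes [measurable]: "A \<in> sets borel"
  shows "emeasure lborel {x. t + 2 * x \<in> A} = ennreal (1 / 2) * emeasure lborel A"
proof -
  have meas: "{x. t + 2 * x \<in> A} \<in> sets borel" by measurable
  have "emeasure lborel {x. t + 2 * x \<in> A} = (\<integral>\<^sup>+x. indicator {x. t + 2 * x \<in> A} x \<partial>lborel)"
    using meas by simp
  also have "\<dots> = \<bar>1 / 2 :: real\<bar> * (\<integral>\<^sup>+x. indicator {x. t + 2 * x \<in> A} (- t / 2 + 1 / 2 * x) \<partial>lborel)"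
    using meas by (intro nn_integral_real_affine) auto
  also have "(\<lambda>x. indicator {x. t + 2 * x \<in> A} (- t / 2 + 1 / 2 * x)) = (indicator A :: real \<Rightarrow> ennreal)"
    by (auto simp: fun_eq_iff indicator_def field_simps)
  finally show ?thesis by simp
qed

text \<open>The two branches \<open>2 * x\<close> and \<open>2 * x - 1\<close> each contribute half
  of the measure.\<close>

lemma emeasure_T_preimage_le:
  assumes [measurable]: "A \<in> sets borel"
  shows "emeasure lborel ({0..1} \<inter> T -` A) \<le> emeasure lborel ({0..1} \<inter> A)"
proof -
  define P where "P t = {x :: real. t + 2 * x \<in> {0..1} \<inter> A}" for t
  have P [measurable]: "P t \<in> sets borel" for t unfolding P_def by measurable
  have emP: "emeasure lborel (P t) = ennreal (1 / 2) * emeasure lborel ({0..1} \<inter> A)" for t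
    unfolding P_def by (rule emeasure_lborel_doubling) measurable
  \<comment> \<open>The point 1 is split off because \<open>T 1 = 0\<close> does not follow the
    branch \<open>2 * x - 1\<close>; it is a null set.\<close>
  have "{0..1} \<inter> T -` A \<subseteq> P 0 \<union> P (-1) \<union> {1}"
  proof
    fix x assume x: "x \<in> {0..1} \<inter> T -` A"
    show "x \<in> P 0 \<union> P (-1) \<union> {1}"
    proof (cases "x = 1")
      case False
      then have "0 \<le> x" "x < 1" using x by auto
      from T_eq[OF this] show ?thesis using x False by (auto simp: P_def split: if_splits)
    qed simp
  qed
  then have "emeasure lborel ({0..1} \<inter> T -` A) \<le> emeasure lborel (P 0 \<union> P (-1) \<union> {1})"
    by (intro emeasure_mono) auto
  also have "\<dots> \<le> emeasure lborel (P 0 \<union> P (-1)) + emeasure lborel {1::real}"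
    by (intro emeasure_subadditive) auto
  also have "\<dots> \<le> emeasure lborel (P 0) + emeasure lborel (P (-1))"
    by (simp add: emeasure_subadditive)
  also have "\<dots> = (ennreal (1 / 2) + ennreal (1 / 2)) * emeasure lborel ({0..1} \<inter> A)"
    by (simp only: emP distrib_right)
  also have "\<dots> = emeasure lborel ({0..1} \<inter> A)"
  proof -
    have "ennreal (1 / 2) + ennreal (1 / 2) = 1" by (subst ennreal_plus[symmetric]) auto
    then show ?thesis by simp
  qed
  finally show ?thesis .
qed

lemma emeasure_funpow_T_preimage_le:
  assumes "A \<in> sets borel"
  shows "emeasure lborel ({0..1} \<inter> (T ^^ j) -` A) \<le> emeasure lborel ({0..1} \<inter> A)"
  using assms
proof (induction j arbitrary: A)
  case (Suc j)
  have "(T ^^ Suc j) -` A = (T ^^ j) -` (T -` A)" by auto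
  moreover have "T -` A \<in> sets borel"
    using measurable_sets[OF T_measurable Suc.prems] by simp
  ultimately show ?case
    using order_trans[OF Suc.IH emeasure_T_preimage_le[OF Suc.prems]] by (simp only:)
qed simp

lemma close_orbits_sets:
  "{z \<in> space nu. \<bar>(T ^^ i) (fst z) - (T ^^ j) (snd z)\<bar> < r} \<in> sets nu"
  by measurable

text \<open>By Fubini it suffices to fix \<open>x\<close>: the section is the preimage under
  \<open>T ^^ j\<close> of an interval of length \<open>2 * r\<close>, and iterating
  \<open>T\<close> does not increase the measure of preimages.\<close>

lemma measure_close_orbits_le:
  assumes "0 \<le> r"
  shows "measure nu {z \<in> space nu. \<bar>(T ^^ i) (fst z) - (T ^^ j) (snd z)\<bar> < r} \<le> 2 * r"
proof -
  define S where "S = {z \<in> space nu. \<bar>(T ^^ i) (fst z) - (T ^^ j) (snd z)\<bar> < r}"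
  have S: "S \<in> sets nu" unfolding S_def by (rule close_orbits_sets)
  have "emeasure nu S = (\<integral>\<^sup>+x. emeasure mu (Pair x -` S) \<partial>mu)"
    by (rule mu.emeasure_pair_measure_alt[OF S])
  also have "\<dots> \<le> (\<integral>\<^sup>+x. ennreal (2 * r) \<partial>mu)"
  proof (rule nn_integral_mono)
    fix x assume x: "x \<in> space mu"
    define c where "c = (T ^^ i) x"
    have eq: "Pair x -` S = {0..1} \<inter> (T ^^ j) -` {c - r<..<c + r}"
      using x by (auto simp: S_def space_nu space_mu c_def)
    have "(T ^^ j) -` {c - r<..<c + r} \<in> sets borel"
      using measurable_sets[OF funpow_T_measurable, of "{c - r<..<c + r}" j] by simp
    then have "emeasure mu (Pair x -` S) = emeasure lborel ({0..1} \<inter> (T ^^ j) -` {c - r<..<c + r})"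
      unfolding eq by (intro emeasure_mu) auto
    also have "\<dots> \<le> emeasure lborel ({0..1} \<inter> {c - r<..<c + r})"
      by (rule emeasure_funpow_T_preimage_le) simp
    also have "\<dots> \<le> emeasure lborel {c - r<..<c + r}"
      by (intro emeasure_mono) auto
    also have "\<dots> = ennreal (2 * r)"
      using assms by simp
    finally show "emeasure mu (Pair x -` S) \<le> ennreal (2 * r)" .
  qed
  also have "\<dots> = ennreal (2 * r)"
    by (simp add: mu.emeasure_space_1)
  finally show ?thesis
    using assms unfolding S_def by (simp add: mu2.emeasure_eq_measure)
qed

lemma E_eq: "E n r = (\<Union>(i, j)\<in>{..<n} \<times> {..<n}.
    {z \<in> space nu. \<bar>(T ^^ i) (fst z) - (T ^^ j) (snd z)\<bar> < r})"
proof (rule set_eqI)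
  fix z :: "real \<times> real"
  obtain x y where z: "z = (x, y)" by (cases z)
  show "z \<in> E n r \<longleftrightarrow> z \<in> (\<Union>(i, j)\<in>{..<n} \<times> {..<n}.
    {z \<in> space nu. \<bar>(T ^^ i) (fst z) - (T ^^ j) (snd z)\<bar> < r})"
    by (simp only: z E_def X_def space_nu UN_iff) (simp add: Bex_def, blast)
qed

lemma E_sets [measurable]: "E n r \<in> sets nu"
  unfolding E_eq by (intro sets.finite_UN) (auto simp: close_orbits_sets)

lemma measure_E_le:
  assumes "0 \<le> r"
  shows "measure nu (E n r) \<le> 2 * (real n)\<^sup>2 * r"
proof -
  let ?D = "\<lambda>(i, j). {z \<in> space nu. \<bar>(T ^^ i) (fst z) - (T ^^ j) (snd z)\<bar> < r}"
  have "measure nu (E n r) \<le> (\<Sum>p\<in>{..<n} \<times> {..<n}. measure nu (?D p))"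
    unfolding E_eq
    by (intro mu2.finite_measure_subadditive_finite) (auto simp: close_orbits_sets)
  also have "\<dots> \<le> (\<Sum>p\<in>{..<n} \<times> {..<n}. 2 * r)"
    using measure_close_orbits_le[OF assms] by (intro sum_mono) auto
  also have "\<dots> = 2 * (real n)\<^sup>2 * r"
    by (simp add: power2_eq_square)
  finally show ?thesis .
qed

lemma limsup_E_sets: "limsup_set (\<lambda>n. E n (r n)) \<in> sets nu"
proof -
  have "(\<Union>n\<in>{m..}. E n (r n)) \<in> sets nu" for m :: nat
    by (intro sets.countable_UN') auto
  then show ?thesis
    unfolding limsup_set_def by (intro sets.countable_INT') auto
qed

section \<open>The convergent case\<close>

lemma limsup_E_null:
  fixes r :: "nat \<Rightarrow> real"
  assumes pos: "\<And>n. n \<ge> 1 \<Longrightarrow> r n > 0"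
    and dec: "\<And>n. n \<ge> 1 \<Longrightarrow> r (Suc n) \<le> r n"
    and dec2: "\<And>n. n \<ge> 1 \<Longrightarrow> real (Suc n) * r (Suc n) \<le> real n * r n"
    and sum: "summable (\<lambda>n. real n * r n)"
  shows "emeasure nu (limsup_set (\<lambda>n. E n (r n))) = 0"
proof -
  \<comment> \<open>\<open>F k\<close> contains \<open>E n (r n)\<close> for every \<open>n\<close>
    with \<open>2 ^ k \<le> n < 2 ^ Suc k\<close>: it takes an upper bound for these indices and the
    largest of the radii.\<close>
  define F where "F k = E (2 ^ Suc k) (r (2 ^ k))" for k
  have mono: "r n \<le> r m" if "1 \<le> m" "m \<le> n" for m n
    using that(2)
  proof (induction rule: dec_induct)
    case (step n)
    then show ?case using dec[of n] that(1) by linarith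
  qed simp
  \<comment> \<open>At \<open>n = 0\<close> the product vanishes whatever the value
    \<open>r 0\<close> is.\<close>
  have nonneg: "0 \<le> real n * r n" for n
    using pos[of n] by (cases n) auto
  have "summable (\<lambda>k. 2 ^ k * (real (2 ^ k) * r (2 ^ k)))"
    using sum condensation_test[of "\<lambda>n. real n * r n"] dec2 nonneg by simp
  \<comment> \<open>The factor 8 is the 2 from \<open>measure_E_le\<close> times the 4 from squaring
    \<open>2 ^ Suc k\<close> in place of \<open>2 ^ k\<close>.\<close>
  then have "summable (\<lambda>k. 8 * (2 ^ k * (real (2 ^ k) * r (2 ^ k))))"
    by (rule summable_mult)
  then have "summable (\<lambda>k. measure nu (F k))"
  proof (rule summable_comparison_test[rotated], intro exI allI impI)
    fix k :: nat
    have "measure nu (F k) \<le> 2 * (real (2 ^ Suc k))\<^sup>2 * r (2 ^ k)"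
      unfolding F_def using pos[of "2 ^ k"] by (intro measure_E_le) simp
    also have "\<dots> = 8 * (2 ^ k * (real (2 ^ k) * r (2 ^ k)))"
      by (simp add: power2_eq_square)
    finally show "norm (measure nu (F k)) \<le> 8 * (2 ^ k * (real (2 ^ k) * r (2 ^ k)))"
      by simp
  qed
  then have "AE z in nu. eventually (\<lambda>k. z \<in> space nu - F k) sequentially"
    by (intro borel_cantelli_AE1) (auto simp: F_def mu2.emeasure_eq_measure)
  then have "AE z in nu. z \<notin> limsup_set (\<lambda>n. E n (r n))"
  proof (rule AE_mp, intro AE_I2 impI notI)
    fix z assume "eventually (\<lambda>k. z \<in> space nu - F k) sequentially"
    then obtain K where K: "\<And>k. k \<ge> K \<Longrightarrow> z \<notin> F k"
      unfolding eventually_sequentially by auto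
    assume "z \<in> limsup_set (\<lambda>n. E n (r n))"
    then have "z \<in> (\<Union>n\<in>{2 ^ K..}. E n (r n))"
      unfolding limsup_set_def by (rule INT_D) simp
    then obtain n where n: "n \<ge> 2 ^ K" "z \<in> E n (r n)" by auto
    have "n > 0" using n(1) by (metis less_le_trans zero_less_numeral zero_less_power)
    then obtain k where k: "2 ^ k \<le> n" "n < 2 ^ Suc k"
      using ex_power_ivl1[of 2 n] by auto
    have "K \<le> k"
    proof (rule ccontr)
      assume "\<not> K \<le> k"
      then have "(2::nat) ^ Suc k \<le> 2 ^ K" by (intro power_increasing) auto
      then show False using k n by linarith
    qed
    have "r n \<le> r (2 ^ k)" using k by (intro mono) auto
    obtain x y i j where "z = (x, y)" "x \<in> X" "y \<in> X" "i < n" "j < n" "\<bar>(T ^^ i) x - (T ^^ j) y\<bar> < r n"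
      using n(2) unfolding E_def by auto
    then have "i < 2 ^ Suc k" "j < 2 ^ Suc k" "\<bar>(T ^^ i) x - (T ^^ j) y\<bar> < r (2 ^ k)"
      using k(2) \<open>r n \<le> r (2 ^ k)\<close> by linarith+
    then have "z \<in> F k"
      using \<open>z = (x, y)\<close> \<open>x \<in> X\<close> \<open>y \<in> X\<close> unfolding F_def E_def by blast
    then show False using K \<open>K \<le> k\<close> by blast
  qed
  then have "limsup_set (\<lambda>n. E n (r n)) \<in> null_sets nu"
    using AE_iff_null_sets[OF limsup_E_sets] by blast
  then show ?thesis by (rule null_setsD1)
qed

section \<open>Correlations and the number of agreements\<close>

text \<open>A bound for the excess of a joint probability over the product, charged to the later
  pair \<open>b\<close>. It is one-sided so that summing over \<open>a\<close> gives a geometric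
  series; general estimates use it in both orders.\<close>

definition diag_corr :: "(nat \<Rightarrow> nat) \<Rightarrow> nat \<times> nat \<Rightarrow> nat \<times> nat \<Rightarrow> real" where
  "diag_corr l a b = (if fst a \<le> fst b \<and> fst a + snd b = fst b + snd a
     then 1 / 2 ^ (fst b - fst a) * (1 / 2 ^ l (fst b)) else 0)"

lemma diag_corr_nonneg: "0 \<le> diag_corr l a b"
  by (simp add: diag_corr_def)

lemma measure_agree_Int_le_ordered:
  fixes l :: "nat \<Rightarrow> nat"
  assumes "mono l" "i \<le> i'" "i + j' = i' + j"
  shows "measure nu (agree i j (l i) \<inter> agree i' j' (l i'))
    \<le> 1 / 2 ^ l i * (1 / 2 ^ l i') + diag_corr l (i, j) (i', j')"
proof -
  define s where "s = i' - i"
  have s: "i' = i + s" "j' = j + s" using assms(2,3) by (auto simp: s_def)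
  have "l i \<le> l i'" using assms(1,2) by (rule monoD)
  then have "measure nu (agree i j (l i) \<inter> agree i' j' (l i')) \<le> 1 / 2 ^ (min (l i) s + l i')"
    unfolding s by (rule measure_agree_Int_same_diagonal)
  \<comment> \<open>The minimum in the exponent selects one of the two summands: the product if the
    windows are disjoint, the correlation term if they overlap.\<close>
  also have "\<dots> \<le> 1 / 2 ^ l i * (1 / 2 ^ l i') + 1 / 2 ^ s * (1 / 2 ^ l i')"
    by (simp add: min_def power_add)
  finally show ?thesis using s by (simp add: diag_corr_def)
qed

lemma measure_agree_Int_le:
  fixes l :: "nat \<Rightarrow> nat"
  assumes "mono l"
  shows "measure nu (agree i j (l i) \<inter> agree i' j' (l i'))
    \<le> 1 / 2 ^ l i * (1 / 2 ^ l i') + diag_corr l (i, j) (i', j') + diag_corr l (i', j') (i, j)"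
proof -
  have nn: "0 \<le> diag_corr l (i, j) (i', j')" "0 \<le> diag_corr l (i', j') (i, j)"
    by (rule diag_corr_nonneg)+
  consider "i + j' < i' + j" | "i' + j < i + j'" | "i + j' = i' + j" "i \<le> i'" | "i' + j = i + j'" "i' \<le> i"
    by linarith
  then show ?thesis
  proof cases
    case 1
    then show ?thesis
      using measure_agree_Int_different_diagonal[of i j' i' j "l i" "l i'"] nn by (simp add: power_add)
  next
    case 2
    then show ?thesis
      using measure_agree_Int_different_diagonal[of i' j i j' "l i'" "l i"] nn
      by (simp add: power_add Int_commute mult.commute)
  next
    case 3
    then show ?thesis
      using measure_agree_Int_le_ordered[OF assms 3(2,1)] nn by linarith
  next
    case 4
    then show ?thesis
      using measure_agree_Int_le_ordered[OF assms 4(2,1)] nn by (simp add: Int_commute mult.commute)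
  qed
qed

text \<open>On the diagonal of \<open>b\<close>, a pair \<open>a\<close> is determined by its
  distance to \<open>b\<close>, so each power of \<open>1 / 2\<close> occurs at most once.\<close>

lemma sum_diag_corr_le:
  assumes "finite F"
  shows "(\<Sum>a\<in>F. diag_corr l a b) \<le> 2 * (1 / 2 ^ l (fst b))"
proof -
  define q :: real where "q = 1 / 2 ^ l (fst b)"
  define G where "G = {a \<in> F. fst a \<le> fst b \<and> fst a + snd b = fst b + snd a}"
  have "(\<Sum>a\<in>F. diag_corr l a b) = (\<Sum>a\<in>G. (1 / 2) ^ (fst b - fst a) * q)"
    unfolding G_def sum.inter_filter[OF assms] diag_corr_def q_def
    by (intro sum.cong) (auto simp: power_one_over)
  also have "\<dots> = (\<Sum>a\<in>G. (1 / 2) ^ (fst b - fst a)) * q"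
    by (simp add: sum_distrib_right)
  also have "\<dots> \<le> 2 * q"
  proof (rule mult_right_mono)
    have "(\<Sum>a\<in>G. (1 / 2 :: real) ^ (fst b - fst a)) = (\<Sum>s\<in>(\<lambda>a. fst b - fst a) ` G. (1 / 2) ^ s)"
    proof (rule sum.reindex_cong[symmetric])
      show "inj_on (\<lambda>a. fst b - fst a) G"
        by (rule inj_onI) (auto simp: G_def prod_eq_iff)
    qed auto
    also have "\<dots> \<le> (\<Sum>s. (1 / 2 :: real) ^ s)"
      using assms by (intro sum_le_suminf summable_geometric) (auto simp: G_def)
    also have "\<dots> = 2" by (simp add: suminf_geometric)
    finally show "(\<Sum>a\<in>G. (1 / 2 :: real) ^ (fst b - fst a)) \<le> 2" .
  qed (simp add: q_def)
  finally show ?thesis by (simp add: q_def)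
qed

text \<open>The constant 4 arises because the correlation terms, taken in both orders, each sum to
  at most twice the sum of the \<open>1 / 2 ^ l i\<close>.\<close>

lemma measure_no_agree_le:
  fixes l :: "nat \<Rightarrow> nat" and F :: "(nat \<times> nat) set"
  assumes l: "mono l" and F: "finite F" "F \<noteq> {}"
  shows "measure nu (space nu - (\<Union>(i, j)\<in>F. agree i j (l i))) \<le> 4 / (\<Sum>(i, j)\<in>F. 1 / 2 ^ l i)"
proof -
  define B where "B = (\<lambda>(i, j). agree i j (l i))"
  define p :: "nat \<times> nat \<Rightarrow> real" where "p a = 1 / 2 ^ l (fst a)" for a
  have "measure nu (space nu - (\<Union>a\<in>F. B a)) \<le> 4 / sum p F"
  proof (rule mu2.second_moment_bound)
    show "B a \<in> sets nu" for a by (auto simp: B_def split: prod.split)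
    show "p a \<le> measure nu (B a)" for a
      by (auto simp: B_def p_def measure_agree_ge split: prod.split)
    show "0 < sum p F" using F by (intro sum_pos) (auto simp: p_def)
    have "(\<Sum>a\<in>F. \<Sum>b\<in>F. measure nu (B a \<inter> B b))
        \<le> (\<Sum>a\<in>F. \<Sum>b\<in>F. p a * p b + diag_corr l a b + diag_corr l b a)"
    proof (intro sum_mono)
      fix a b
      show "measure nu (B a \<inter> B b) \<le> p a * p b + diag_corr l a b + diag_corr l b a"
        using measure_agree_Int_le[OF l, of "fst a" "snd a" "fst b" "snd b"]
        by (simp add: B_def p_def split_def)
    qed
    \<comment> \<open>The first correlation sum is swapped so that in both sums the inner index is
      the earlier pair.\<close>
    also have "\<dots> = (sum p F)\<^sup>2 + (\<Sum>b\<in>F. \<Sum>a\<in>F. diag_corr l a b) + (\<Sum>a\<in>F. \<Sum>b\<in>F. diag_corr l b a)"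
      by (subst (2) sum.swap) (simp add: sum.distrib power2_eq_square sum_product)
    also have "\<dots> \<le> (sum p F)\<^sup>2 + (\<Sum>b\<in>F. 2 * p b) + (\<Sum>a\<in>F. 2 * p a)"
      unfolding p_def by (intro add_mono sum_mono sum_diag_corr_le order_refl F)
    also have "\<dots> = (sum p F)\<^sup>2 + 4 * sum p F"
      by (simp add: sum_distrib_left[symmetric])
    finally show "(\<Sum>a\<in>F. \<Sum>b\<in>F. measure nu (B a \<inter> B b)) \<le> (sum p F)\<^sup>2 + 4 * sum p F" .
  qed (rule F)
  moreover have "sum p F = (\<Sum>(i, j)\<in>F. 1 / 2 ^ l i)"
    by (simp add: p_def split_def)
  ultimately show ?thesis by (simp add: B_def)
qed

section \<open>The divergent case\<close>

lemma agree_subset_E: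
  assumes "1 / 2 ^ m \<le> r" "i < n" "j < n"
  shows "agree i j m \<subseteq> E n r"
proof clarify
  fix x y assume "(x, y) \<in> agree i j m"
  then have x: "x \<in> {0..<1}" and y: "y \<in> {0..<1}"
    and *: "\<And>t. t < m \<Longrightarrow> digit t ((T ^^ i) x) = digit t ((T ^^ j) y)"
    by (auto simp: agree_def digit_add)
  have "\<bar>(T ^^ i) x - (T ^^ j) y\<bar> < 1 / 2 ^ m"
    by (rule dist_less_if_digits_agree[OF funpow_T_range[OF x] funpow_T_range[OF y] *])
  then have "\<bar>(T ^^ i) x - (T ^^ j) y\<bar> < r" using assms(1) by linarith
  moreover have "x \<in> X" "y \<in> X" using x y by (auto simp: X_def)
  ultimately show "(x, y) \<in> E n r" using assms(2,3) unfolding E_def by blast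
qed

lemma not_summable_tail_unbounded:
  fixes f :: "nat \<Rightarrow> real"
  assumes "\<not> summable f" "\<And>n. 0 \<le> f n"
  shows "\<exists>N>K. C < (\<Sum>k\<in>{K..<N}. f k)"
proof (rule ccontr)
  assume "\<not> ?thesis"
  then have le: "(\<Sum>k\<in>{K..<N}. f k) \<le> C" if "N > K" for N using that by force
  have "summable (\<lambda>n. f (n + K))"
  proof (rule summableI_nonneg_bounded)
    \<comment> \<open>The maximum with 0 covers the empty sum, to which \<open>le\<close> does not
      apply.\<close>
    show "(\<Sum>k<n. f (k + K)) \<le> max C 0" for n
    proof (cases "n = 0")
      case False
      have "(\<Sum>k<n. f (k + K)) = (\<Sum>k\<in>{K..<n + K}. f k)"
        using sum.shift_bounds_nat_ivl[of f 0 K n] by (simp add: atLeast0LessThan)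
      then show ?thesis using le[of "n + K"] False by simp
    qed simp
  qed (rule assms(2))
  then show False using assms(1) by (simp add: summable_iff_shift)
qed

lemma limsup_E_full:
  fixes r :: "nat \<Rightarrow> real"
  assumes pos: "\<And>n. n \<ge> 1 \<Longrightarrow> r n > 0"
    and dec: "\<And>n. n \<ge> 1 \<Longrightarrow> r (Suc n) \<le> r n"
    and div: "\<not> summable (\<lambda>n. real n * r n)"
  shows "emeasure nu (limsup_set (\<lambda>n. E n (r n))) = 1"
proof -
  define l where "l k = (LEAST m. 1 / 2 ^ m \<le> r (Suc k))" for k
  \<comment> \<open>If \<open>l k > 0\<close>, minimality of \<open>l k\<close> bounds
    \<open>r (Suc k)\<close> by twice \<open>1 / 2 ^ l k\<close>; if \<open>l k = 0\<close>, only
    the bound \<open>r 1\<close> is at hand. \<open>R\<close> dominates both.\<close>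
  define R where "R = 2 * max 1 (r 1)"
  have l_le: "1 / 2 ^ l k \<le> r (Suc k)" for k
  proof -
    obtain m where "(1 / 2) ^ m < r (Suc k)"
      using real_arch_pow_inv[of "r (Suc k)" "1 / 2"] pos by auto
    then have "1 / 2 ^ m \<le> r (Suc k)" by (simp add: power_one_over)
    then show ?thesis unfolding l_def by (rule LeastI)
  qed
  have mono: "mono l"
  proof (rule mono_iff_le_Suc[THEN iffD2], rule allI)
    fix k
    have "1 / 2 ^ l (Suc k) \<le> r (Suc k)" using l_le[of "Suc k"] dec[of "Suc k"] by linarith
    then show "l k \<le> l (Suc k)" unfolding l_def[of k] by (rule Least_le)
  qed
  have r_le1: "r (Suc k) \<le> r 1" for k
  proof (induction k)
    case (Suc k)
    then show ?case using dec[of "Suc k"] by simp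
  qed simp
  have R: "R > 0" by (simp add: R_def)
  have ge: "r (Suc k) \<le> R * (1 / 2 ^ l k)" for k
  proof (cases "l k")
    case 0
    then show ?thesis using r_le1[of k] by (simp add: R_def)
  next
    case (Suc m)
    then have "\<not> 1 / 2 ^ m \<le> r (Suc k)"
      using not_less_Least[of m "\<lambda>m. 1 / 2 ^ m \<le> r (Suc k)"] by (simp add: l_def)
    then have "r (Suc k) \<le> 2 * (1 / 2 ^ l k)" using Suc by simp
    also have "\<dots> \<le> R * (1 / 2 ^ l k)"
      unfolding R_def by (intro mult_right_mono) auto
    finally show ?thesis .
  qed
  have tail: "measure nu (space nu - (\<Union>n\<in>{m..}. E n (r n))) = 0" if m: "m \<ge> 1" for m
  proof -
    let ?Z = "space nu - (\<Union>n\<in>{m..}. E n (r n))"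
    have le: "measure nu ?Z \<le> e" if e: "e > 0" for e
    proof -
      have "\<not> summable (\<lambda>k. real (Suc k) * r (Suc k))"
        using div by (subst summable_Suc_iff)
      \<comment> \<open>With this threshold the expected number of agreements is at least
        \<open>1 / R\<close> times the block sum, hence above \<open>4 / e\<close>, and
        \<open>measure_no_agree_le\<close> then gives the bound \<open>e\<close>.\<close>
      then obtain N where N: "N > m" "4 * R / e < (\<Sum>k\<in>{m..<N}. real (Suc k) * r (Suc k))"
        using not_summable_tail_unbounded[of "\<lambda>k. real (Suc k) * r (Suc k)" m "4 * R / e"] pos
        by (auto simp: less_imp_le)
      \<comment> \<open>Row \<open>i\<close> has \<open>Suc i\<close> entries, which supply the
        factor \<open>n\<close> in \<open>n * r n\<close> at \<open>n = Suc i\<close>. Starting at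
        \<open>m\<close> keeps every agreement inside the tail union.\<close>
      define F where "F = (SIGMA i:{m..<N}. {..i})"
      have "(m, 0) \<in> F" using N(1) by (simp add: F_def)
      then have F: "finite F" "F \<noteq> {}" by (simp add: F_def, blast)
      have "(\<Sum>k\<in>{m..<N}. real (Suc k) * r (Suc k)) \<le> (\<Sum>k\<in>{m..<N}. real (Suc k) * (R * (1 / 2 ^ l k)))"
        by (intro sum_mono mult_left_mono ge) auto
      also have "\<dots> = R * (\<Sum>i\<in>{m..<N}. \<Sum>j\<in>{..i}. 1 / 2 ^ l i)"
        by (simp add: sum_distrib_left mult_ac)
      also have "\<dots> = R * (\<Sum>(i, j)\<in>F. 1 / 2 ^ l i)"
        unfolding F_def by (subst sum.Sigma) auto
      finally have "R * (4 / e) < R * (\<Sum>(i, j)\<in>F. 1 / 2 ^ l i)"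
        using N(2) by (simp add: mult.commute)
      then have s: "4 / e < (\<Sum>(i, j)\<in>F. 1 / 2 ^ l i)"
        using R by (simp only: mult_less_cancel_left_pos)
      have "agree i j (l i) \<subseteq> (\<Union>n\<in>{m..}. E n (r n))" if "(i, j) \<in> F" for i j
      proof -
        have "agree i j (l i) \<subseteq> E (Suc i) (r (Suc i))"
          using that by (intro agree_subset_E l_le) (auto simp: F_def)
        moreover have "Suc i \<in> {m..}" using that by (simp add: F_def)
        ultimately show ?thesis by blast
      qed
      then have "(\<Union>(i, j)\<in>F. agree i j (l i)) \<subseteq> (\<Union>n\<in>{m..}. E n (r n))"
        by blast
      then have "measure nu ?Z \<le> measure nu (space nu - (\<Union>(i, j)\<in>F. agree i j (l i)))"
        using F by (intro mu2.finite_measure_mono) (auto intro!: sets.Diff sets.finite_UN)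
      also have "\<dots> \<le> 4 / (\<Sum>(i, j)\<in>F. 1 / 2 ^ l i)"
        by (rule measure_no_agree_le[OF mono F])
      also have "\<dots> \<le> e"
      proof -
        have "0 < (\<Sum>(i, j)\<in>F. 1 / 2 ^ l i :: real)"
          using s e by (meson divide_pos_pos less_trans zero_less_numeral)
        then show ?thesis using s e by (simp add: field_simps)
      qed
      finally show ?thesis .
    qed
    have "measure nu ?Z \<le> 0" by (rule field_le_epsilon) (use le in simp)
    then show ?thesis by (simp add: measure_le_0_iff)
  qed
  have "AE z in nu. \<forall>m\<in>{1..}. z \<in> (\<Union>n\<in>{m..}. E n (r n))"
  proof (rule AE_ball_countable'[OF _ countableI_type])
    fix m :: nat assume "m \<in> {1..}"
    have sets: "(\<Union>n\<in>{m..}. E n (r n)) \<in> sets nu"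
      by (intro sets.countable_UN') auto
    have "space nu - (\<Union>n\<in>{m..}. E n (r n)) \<in> null_sets nu"
      using tail[of m] \<open>m \<in> {1..}\<close> sets by (intro null_setsI) (auto simp: mu2.emeasure_eq_measure)
    from AE_not_in[OF this] AE_space show "AE z in nu. z \<in> (\<Union>n\<in>{m..}. E n (r n))"
      by eventually_elim auto
  qed
  then have "AE z in nu. z \<in> limsup_set (\<lambda>n. E n (r n))"
    unfolding limsup_set_def by simp
  then show ?thesis
    using limsup_E_sets by (intro mu2.emeasure_eq_1_AE)
qed

theorem mainTheorem8:
  fixes r :: "nat \<Rightarrow> real"
  assumes pos: "\<And>n. n \<ge> 1 \<Longrightarrow> r n > 0"
    and dec: "\<And>n. n \<ge> 1 \<Longrightarrow> r (Suc n) \<le> r n"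
    and dec2: "\<And>n. n \<ge> 1 \<Longrightarrow> real (Suc n) * r (Suc n) \<le> real n * r n"
  shows "(summable (\<lambda>n. real n * r n) \<longrightarrow>
            emeasure (mu \<Otimes>\<^sub>M mu) (limsup_set (\<lambda>n. E n (r n))) = 0)
       \<and> (\<not> summable (\<lambda>n. real n * r n) \<longrightarrow>
            emeasure (mu \<Otimes>\<^sub>M mu) (limsup_set (\<lambda>n. E n (r n))) = 1)"
  using limsup_E_null[of r, OF pos dec dec2] limsup_E_full[of r, OF pos dec] by blast

end
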